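(* In the absence of fairness constraints, the majority-minimization iteration for fair Wasserstein coresets reduces to Lloyd's algorithm. Precisely: (i) For any $C\in\mathbb R^{n\times m}$ and each $i\in[n]$, let $j_i^\star\in\arg\min_{j\in[m]}C_{ij}$. Then the matrix $P^\star$ with entries $P^\star_{ij}=\frac1n$ if $j=j_i^\star$ and $P^\star_{ij}=0$ otherwise is a minimizer of $\min\{\langle C,P\rangle: P\in\mathbb R^{n\times m},\ P\mathbf 1_m=\frac1n\mathbf 1_n,\ P\ge\mathbf 0\}$. (ii) Consequently, given $\hat X^k\in\mathcal X^m$, if $P_k^\star$ is chosen in this way for $C=C(\hat X^k)$, then the update $\hat X^{k+1}\in\arg\min_{\hat X\in\mathcal X^m}\langle C(\hat X),P_k^\star\rangle$ is one step of Lloyd's algorithm in which the centroids have fixed $\hat D_j,\hat Y_j$ components: each $Z_i$ is assigned to the cluster $S_j$ ($j=j_i^\star$) of a closest current centroid $\hat Z_j^k=(\hat D_j,\hat X_j^k,\hat Y_j)$ with respect to $c$, and then each $\hat X_j^{k+1}$ is a minimizer over $\hat X_j\in\mathcal X$ of $\sum_{i\in S_j}c(Z_i,(\hat D_j,\hat X_j,\hat Y_j))$. For $c(x,y)=\|x-y\|_1$ this is the k-medians version, and for $c(x,y)=\|x-y\|_2^2$ the k-means version; in the latter case, if $\mathcal X$ is convex, $\hat X_j^{k+1}=\frac1{|S_j|}\sum_{i\in S_j}X_i$ whenever $S_j\neq\emptyset$.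
   Context: $\mathcal Z=\mathcal D\times\mathcal X\times\mathcal Y\subseteq\mathbb R^d$ with $\mathcal D,\mathcal Y$ finite (numerically encoded). The data are $Z_i=(D_i,X_i,Y_i)\in\mathcal Z$, $i\in[n]$. The coreset points are $\hat Z_j=(\hat D_j,\hat X_j,\hat Y_j)$, $j\in[m]$, with $\hat D_j\in\mathcal D$, $\hat Y_j\in\mathcal Y$ fixed and $\hat X=(\hat X_1,\dots,\hat X_m)\in\mathcal X^m$ variable. $C(\hat X)\in\mathbb R^{n\times m}$ has entries $C(\hat X)_{ij}=c(Z_i,\hat Z_j)$ for a cost $c:\mathcal Z\times\mathcal Z\to[0,\infty)$. $\langle C,P\rangle=\sum_{ij}C_{ij}P_{ij}$ and $\mathbf 1_k$ is the all-ones vector in $\mathbb R^k$. The majority-minimization iteration without fairness constraints is: given $\hat X^k$, compute a minimizer $P_k^\star$ of $\langle C(\hat X^k),P\rangle$ over $\{P\ge\mathbf 0,\ P\mathbf 1_m=\frac1n\mathbf 1_n\}$, then take $\hat X^{k+1}$ to be a minimizer of $\langle C(\hat X),P_k^\star\rangle$ over $\hat X\in\mathcal X^m$. Lloyd's algorithm alternates between assigning every data point to a closest centroid and replacing each centroid by a minimizer of the total cost to the points assigned to it. *)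

theory Defs
  imports "HOL-Analysis.Analysis"
begin

text \<open>
  The ambient space is the product of three coordinate spaces, so its \<open>norm\<close> is the Euclidean
  norm of the concatenated vector and its \<open>Basis\<close> consists of the standard coordinate vectors.
  The index sets of data points and of coreset points are the finite types \<open>'n\<close> and \<open>'m\<close>.
\<close>

type_synonym ('d, 'p, 'y) point = "(real ^ 'd) \<times> (real ^ 'p) \<times> (real ^ 'y)"

definition l1_norm :: "'a::euclidean_space \<Rightarrow> real" where
  "l1_norm x = (\<Sum>b\<in>Basis. \<bar>x \<bullet> b\<bar>)"

definition coreset ::
  "('m \<Rightarrow> real ^ 'd) \<Rightarrow> ('m \<Rightarrow> real ^ 'y) \<Rightarrow> (real ^ 'p) ^ 'm \<Rightarrow> 'm \<Rightarrow> ('d, 'p, 'y) point" where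
  "coreset Dh Yh Xh j = (Dh j, Xh $ j, Yh j)"

definition cost_matrix ::
  "(('d, 'p, 'y) point \<Rightarrow> ('d, 'p, 'y) point \<Rightarrow> real) \<Rightarrow> ('n \<Rightarrow> ('d, 'p, 'y) point) \<Rightarrow>
   ('m \<Rightarrow> real ^ 'd) \<Rightarrow> ('m \<Rightarrow> real ^ 'y) \<Rightarrow> (real ^ 'p) ^ 'm \<Rightarrow> real ^ 'm ^ 'n" where
  "cost_matrix c Z Dh Yh Xh = (\<chi> i j. c (Z i) (coreset Dh Yh Xh j))"

definition plans :: "(real ^ 'm ^ 'n) set" where
  "plans = {P. (\<forall>i j. 0 \<le> P $ i $ j) \<and> P *v vec 1 = (1 / real CARD('n)) *\<^sub>R vec 1}"

definition assignment_plan :: "('n \<Rightarrow> 'm) \<Rightarrow> real ^ 'm ^ 'n" where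
  "assignment_plan a = (\<chi> i j. if j = a i then 1 / real CARD('n) else 0)"

definition cluster :: "('n \<Rightarrow> 'm) \<Rightarrow> 'm \<Rightarrow> 'n set" where
  "cluster a j = {i. a i = j}"

text \<open>
  One step of the majority-minimization iteration, from \<open>Xk\<close> via the plan \<open>P\<close> to \<open>Xk'\<close>.
  The inner product of two matrices is the sum of the products of their entries.
\<close>

definition mm_step ::
  "(('d, 'p, 'y) point \<Rightarrow> ('d, 'p, 'y) point \<Rightarrow> real) \<Rightarrow> (real ^ 'p) set \<Rightarrow>
   ('n \<Rightarrow> ('d, 'p, 'y) point) \<Rightarrow> ('m \<Rightarrow> real ^ 'd) \<Rightarrow> ('m \<Rightarrow> real ^ 'y) \<Rightarrow>
   (real ^ 'p) ^ 'm \<Rightarrow> real ^ 'm ^ 'n \<Rightarrow> (real ^ 'p) ^ 'm \<Rightarrow> bool" where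
  "mm_step c \<X> Z Dh Yh Xk P Xk' \<longleftrightarrow>
     is_arg_min (\<lambda>Q. cost_matrix c Z Dh Yh Xk \<bullet> Q) (\<lambda>Q. Q \<in> plans) P \<and>
     is_arg_min (\<lambda>Xh. cost_matrix c Z Dh Yh Xh \<bullet> P) (\<lambda>Xh. \<forall>j. Xh $ j \<in> \<X>) Xk'"

text \<open>
  One step of Lloyd's algorithm for the cost \<open>c\<close>, from the centroids \<open>z\<close> via the assignment \<open>a\<close>
  to the centroids \<open>z'\<close>; the \<open>j\<close>-th centroid ranges over \<open>A j\<close>. The k-medians and k-means versions
  measure cost by the 1-norm distance and by the squared Euclidean distance.
\<close>

definition lloyd_step ::
  "('a \<Rightarrow> 'a \<Rightarrow> real) \<Rightarrow> ('n \<Rightarrow> 'a) \<Rightarrow> ('m \<Rightarrow> 'a set) \<Rightarrow>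
   ('m \<Rightarrow> 'a) \<Rightarrow> ('n \<Rightarrow> 'm) \<Rightarrow> ('m \<Rightarrow> 'a) \<Rightarrow> bool" where
  "lloyd_step c Z A z a z' \<longleftrightarrow>
     (\<forall>i. is_arg_min (\<lambda>j. c (Z i) (z j)) (\<lambda>j. True) (a i)) \<and>
     (\<forall>j. is_arg_min (\<lambda>w. \<Sum>i\<in>cluster a j. c (Z i) w) (\<lambda>w. w \<in> A j) (z' j))"

definition k_medians_step ::
  "('n \<Rightarrow> 'a::euclidean_space) \<Rightarrow> ('m \<Rightarrow> 'a set) \<Rightarrow>
   ('m \<Rightarrow> 'a) \<Rightarrow> ('n \<Rightarrow> 'm) \<Rightarrow> ('m \<Rightarrow> 'a) \<Rightarrow> bool" where
  "k_medians_step = lloyd_step (\<lambda>x y. l1_norm (x - y))"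

definition k_means_step ::
  "('n \<Rightarrow> 'a::euclidean_space) \<Rightarrow> ('m \<Rightarrow> 'a set) \<Rightarrow>
   ('m \<Rightarrow> 'a) \<Rightarrow> ('n \<Rightarrow> 'm) \<Rightarrow> ('m \<Rightarrow> 'a) \<Rightarrow> bool" where
  "k_means_step = lloyd_step (\<lambda>x y. (norm (x - y))\<^sup>2)"

end

(* Each row of a feasible plan has mass 1/n, so the mass of a row is best spent on a cheapest
   column. For such a plan the objective is 1/n times the sum of the within-cluster costs, and the
   j-th of these depends only on the j-th coreset point; hence the update splits into m independent
   centroid problems. For the squared Euclidean cost, each is solved by the cluster mean, by the
   parallel axis identity. *)
theory Submission imports Defs begin

section \<open>Transport plans and the linear objective\<close>

lemma inner_matrix:
  fixes C P :: "real ^ 'm ^ 'n"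
  shows "C \<bullet> P = (\<Sum>i\<in>UNIV. \<Sum>j\<in>UNIV. C $ i $ j * P $ i $ j)"
  by (simp add: inner_vec_def)

lemma mem_plans_iff:
  fixes P :: "real ^ 'm::finite ^ 'n::finite"
  shows "P \<in> plans \<longleftrightarrow>
    (\<forall>i j. 0 \<le> P $ i $ j) \<and> (\<forall>i. (\<Sum>j\<in>UNIV. P $ i $ j) = 1 / real CARD('n))"
  by (simp add: plans_def vec_eq_iff matrix_vector_mult_def)

lemma assignment_plan_in_plans: "assignment_plan a \<in> plans"
  by (simp add: mem_plans_iff assignment_plan_def)

lemma inner_assignment_plan:
  fixes C :: "real ^ 'm::finite ^ 'n::finite"
  shows "C \<bullet> assignment_plan a = (\<Sum>i\<in>UNIV. C $ i $ a i) / real CARD('n)"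
proof -
  have "C \<bullet> assignment_plan a = (\<Sum>i\<in>UNIV. C $ i $ a i / real CARD('n))"
    by (simp add: inner_matrix assignment_plan_def if_distrib cong: if_cong)
  then show ?thesis
    by (simp add: sum_divide_distrib)
qed

lemma assignment_plan_optimal:
  fixes C :: "real ^ 'm::finite ^ 'n::finite"
  assumes "\<And>i. is_arg_min (\<lambda>j. C $ i $ j) (\<lambda>j. True) (a i)"
  shows "is_arg_min (\<lambda>P. C \<bullet> P) (\<lambda>P. P \<in> plans) (assignment_plan a)"
proof -
  have "C \<bullet> assignment_plan a \<le> C \<bullet> P" if P: "P \<in> plans" for P
  proof -
    have "C $ i $ a i / real CARD('n) \<le> (\<Sum>j\<in>UNIV. C $ i $ j * P $ i $ j)" for i
    proof -
      \<comment> \<open>The constant 1/n is written as the row sum of \<open>P\<close>, so that the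
        row minimum can be compared with the entries column by column, with nonnegative
        weights.\<close>
      have "C $ i $ a i / real CARD('n) = (\<Sum>j\<in>UNIV. C $ i $ a i * P $ i $ j)"
        using P by (simp add: mem_plans_iff flip: sum_distrib_left)
      also have "\<dots> \<le> (\<Sum>j\<in>UNIV. C $ i $ j * P $ i $ j)"
        using assms P by (intro sum_mono mult_right_mono)
          (auto simp: mem_plans_iff is_arg_min_linorder)
      finally show ?thesis .
    qed
    then show ?thesis
      unfolding inner_assignment_plan inner_matrix[of C P] sum_divide_distrib
      by (intro sum_mono)
  qed
  then show ?thesis
    by (simp add: is_arg_min_linorder assignment_plan_in_plans)
qed

lemma cost_assignment_plan:
  fixes Z :: "'n::finite \<Rightarrow> ('d::finite, 'p::finite, 'y::finite) point"
    and Xh :: "(real ^ 'p) ^ 'm::finite"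
  shows "cost_matrix c Z Dh Yh Xh \<bullet> assignment_plan a =
    (\<Sum>j\<in>UNIV. \<Sum>i\<in>cluster a j. c (Z i) (Dh j, Xh $ j, Yh j)) / real CARD('n)"
proof -
  have "(\<Sum>i\<in>UNIV. c (Z i) (coreset Dh Yh Xh (a i))) =
      (\<Sum>j\<in>UNIV. \<Sum>i\<in>cluster a j. c (Z i) (coreset Dh Yh Xh (a i)))"
    \<comment> \<open>The clusters are the fibres of \<open>a\<close>, so they partition the data
      indices; empty fibres contribute 0.\<close>
    using sum.group[of UNIV UNIV a "\<lambda>i. c (Z i) (coreset Dh Yh Xh (a i))"]
    by (simp add: cluster_def)
  also have "\<dots> = (\<Sum>j\<in>UNIV. \<Sum>i\<in>cluster a j. c (Z i) (Dh j, Xh $ j, Yh j))"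
    by (simp add: cluster_def coreset_def)
  finally show ?thesis
    by (simp add: inner_assignment_plan cost_matrix_def)
qed

section \<open>Splitting the update into independent centroid problems\<close>

lemma is_arg_min_divide_iff:
  fixes f :: "'a \<Rightarrow> real"
  assumes "0 < r"
  shows "is_arg_min (\<lambda>x. f x / r) P x \<longleftrightarrow> is_arg_min f P x"
  using assms by (simp add: is_arg_min_def divide_less_cancel)

text \<open>The feasible set is a product and the objective is separable, so each component can be
  varied while the others stay fixed.\<close>

lemma is_arg_min_sum_components:
  fixes g :: "'m::finite \<Rightarrow> 'a \<Rightarrow> real" and x :: "'a ^ 'm"
  shows "is_arg_min (\<lambda>x. \<Sum>j\<in>UNIV. g j (x $ j)) (\<lambda>x. \<forall>j. x $ j \<in> S) x \<longleftrightarrow>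
    (\<forall>j. is_arg_min (g j) (\<lambda>y. y \<in> S) (x $ j))" (is "?L \<longleftrightarrow> ?R")
proof
  assume L: ?L
  show ?R
  proof
    fix k
    have "g k (x $ k) \<le> g k y" if y: "y \<in> S" for y
    proof -
      \<comment> \<open>The competitor differs from \<open>x\<close> only at \<open>k\<close>. It is
        still feasible, and all terms other than the \<open>k\<close>-th cancel when the two sums
        are compared.\<close>
      let ?x' = "\<chi> j. if j = k then y else x $ j"
      have "(\<Sum>j\<in>UNIV. g j (x $ j)) \<le> (\<Sum>j\<in>UNIV. g j (?x' $ j))"
        using L y unfolding is_arg_min_linorder
        by (elim conjE allE[of _ ?x']) simp
      then show ?thesis
        by (simp add: sum.remove[of UNIV k])
    qed
    then show "is_arg_min (g k) (\<lambda>y. y \<in> S) (x $ k)"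
      using L by (simp add: is_arg_min_linorder)
  qed
next
  assume ?R
  then show ?L
    by (auto simp: is_arg_min_linorder intro: sum_mono)
qed

text \<open>Links the two views of an update: Lloyd's step moves a full point inside a slice,
  whereas the iteration varies only the middle component.\<close>

lemma is_arg_min_fixed_outer_components:
  "is_arg_min f (\<lambda>w. w \<in> {d} \<times> S \<times> {y}) (d, x, y) \<longleftrightarrow>
    is_arg_min (\<lambda>x. f (d, x, y)) (\<lambda>x. x \<in> S) x"
  by (auto simp: is_arg_min_def)

text \<open>Optimality of the plan is automatic by \<open>assignment_plan_optimal\<close>, so only
  the update condition remains. Its objective is separable up to the positive factor 1/n, which does
  not affect minimizers.\<close>

lemma mm_step_assignment_plan_iff:
  fixes Z :: "'n::finite \<Rightarrow> ('d::finite, 'p::finite, 'y::finite) point"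
    and Xk :: "(real ^ 'p) ^ 'm::finite"
  assumes "\<And>i. is_arg_min (\<lambda>j. cost_matrix c Z Dh Yh Xk $ i $ j) (\<lambda>j. True) (a i)"
  shows "mm_step c S Z Dh Yh Xk (assignment_plan a) Xk' \<longleftrightarrow>
    (\<forall>j. is_arg_min (\<lambda>x. \<Sum>i\<in>cluster a j. c (Z i) (Dh j, x, Yh j)) (\<lambda>x. x \<in> S) (Xk' $ j))"
  using assignment_plan_optimal[OF assms]
    is_arg_min_sum_components[of "\<lambda>j x. \<Sum>i\<in>cluster a j. c (Z i) (Dh j, x, Yh j)" S Xk']
  by (simp add: mm_step_def cost_assignment_plan is_arg_min_divide_iff)

text \<open>The assignment half of \<open>lloyd_step\<close> is the hypothesis on \<open>a\<close>;
  the update halves agree cluster by cluster. For an empty cluster both objectives are 0, so every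
  admissible centroid is a minimizer.\<close>

lemma mm_step_iff_lloyd_step:
  fixes Z :: "'n::finite \<Rightarrow> ('d::finite, 'p::finite, 'y::finite) point"
    and Xk :: "(real ^ 'p) ^ 'm::finite"
  assumes "\<And>i. is_arg_min (\<lambda>j. cost_matrix c Z Dh Yh Xk $ i $ j) (\<lambda>j. True) (a i)"
  shows "mm_step c S Z Dh Yh Xk (assignment_plan a) Xk' \<longleftrightarrow>
    lloyd_step c Z (\<lambda>j. {Dh j} \<times> S \<times> {Yh j}) (coreset Dh Yh Xk) a (coreset Dh Yh Xk')"
proof -
  have "is_arg_min (\<lambda>j. c (Z i) (coreset Dh Yh Xk j)) (\<lambda>j. True) (a i)" for i
    using assms[of i] by (simp add: cost_matrix_def)
  then show ?thesis
    unfolding mm_step_assignment_plan_iff[OF assms] lloyd_step_def coreset_def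
      is_arg_min_fixed_outer_components by simp
qed

section \<open>Replacing the cost by one that agrees where it is evaluated\<close>

lemma is_arg_min_cong:
  assumes "\<And>y. P y \<Longrightarrow> f y = g y"
  shows "is_arg_min f P x \<longleftrightarrow> is_arg_min g P x"
  using assms by (auto simp: is_arg_min_def)

text \<open>A step evaluates the cost only between data points and current centroids or admissible
  candidates. This allows a cost whose formula is prescribed only on the data space.\<close>

lemma lloyd_step_cong:
  assumes "\<And>i j. c (Z i) (z j) = c' (Z i) (z j)"
    and "\<And>i j w. w \<in> A j \<Longrightarrow> c (Z i) w = c' (Z i) w"
  shows "lloyd_step c Z A z a z' \<longleftrightarrow> lloyd_step c' Z A z a z'"
proof -
  have "is_arg_min (\<lambda>w. \<Sum>i\<in>cluster a j. c (Z i) w) (\<lambda>w. w \<in> A j) (z' j) \<longleftrightarrow>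
      is_arg_min (\<lambda>w. \<Sum>i\<in>cluster a j. c' (Z i) w) (\<lambda>w. w \<in> A j) (z' j)" for j
    by (rule is_arg_min_cong) (simp add: assms(2))
  then show ?thesis
    by (simp add: lloyd_step_def assms(1))
qed

section \<open>The mean as minimizer of the squared Euclidean cost\<close>

lemma sum_norm_diff_squared_mean:
  fixes f :: "'i \<Rightarrow> 'a::real_inner"
  assumes "finite I" and "I \<noteq> {}"
  defines "\<mu> \<equiv> (1 / real (card I)) *\<^sub>R sum f I"
  shows "(\<Sum>i\<in>I. (norm (f i - x))\<^sup>2) =
    (\<Sum>i\<in>I. (norm (f i - \<mu>))\<^sup>2) + real (card I) * (norm (\<mu> - x))\<^sup>2"
proof -
  have "sum f I = real (card I) *\<^sub>R \<mu>"
    using assms by simp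
  then have zero: "(\<Sum>i\<in>I. f i - \<mu>) = 0"
    by (simp add: sum_subtractf sum_constant_scaleR)
  \<comment> \<open>Expansion of \<open>(f i - \<mu>) + (\<mu> - x)\<close>. After summation the
    cross term vanishes by \<open>zero\<close>, since the deviations from the mean cancel.\<close>
  have "(norm (f i - x))\<^sup>2 =
      (norm (f i - \<mu>))\<^sup>2 + (2 * ((f i - \<mu>) \<bullet> (\<mu> - x)) + (norm (\<mu> - x))\<^sup>2)" for i
    by (simp add: power2_norm_eq_inner algebra_simps inner_commute)
  then have "(\<Sum>i\<in>I. (norm (f i - x))\<^sup>2) = (\<Sum>i\<in>I. (norm (f i - \<mu>))\<^sup>2) +
      (2 * ((\<Sum>i\<in>I. f i - \<mu>) \<bullet> (\<mu> - x)) + real (card I) * (norm (\<mu> - x))\<^sup>2)"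
    by (simp add: sum.distrib sum_distrib_left inner_sum_left)
  then show ?thesis
    by (simp add: zero)
qed

text \<open>Convexity makes the mean an admissible competitor. By the parallel axis identity, a
  minimizer elsewhere would have an excess cost proportional to its squared distance from the mean,
  so the minimizer is unique.\<close>

lemma is_arg_min_sum_norm_squared_mean:
  fixes f :: "'i \<Rightarrow> 'a::real_inner"
  assumes "finite I" and "I \<noteq> {}" and "convex S" and "\<And>i. i \<in> I \<Longrightarrow> f i \<in> S"
    and "is_arg_min (\<lambda>x. \<Sum>i\<in>I. (norm (f i - x))\<^sup>2) (\<lambda>x. x \<in> S) x"
  shows "x = (1 / real (card I)) *\<^sub>R sum f I"
proof -
  let ?\<mu> = "(1 / real (card I)) *\<^sub>R sum f I"
  have card: "0 < real (card I)"
    using assms by (simp add: card_gt_0_iff)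
  have "(\<Sum>i\<in>I. (1 / real (card I)) *\<^sub>R f i) \<in> S"
    using assms(1,3,4) card by (intro convex_sum) auto
  then have "?\<mu> \<in> S"
    by (simp add: scaleR_right.sum)
  then have "(\<Sum>i\<in>I. (norm (f i - x))\<^sup>2) \<le> (\<Sum>i\<in>I. (norm (f i - ?\<mu>))\<^sup>2)"
    using assms(5) by (simp add: is_arg_min_linorder)
  then have "real (card I) * (norm (?\<mu> - x))\<^sup>2 \<le> 0"
    using sum_norm_diff_squared_mean[OF assms(1,2), of f x] by linarith
  then have "(norm (?\<mu> - x))\<^sup>2 \<le> 0"
    using card by (simp add: mult_le_0_iff)
  then show ?thesis
    by simp
qed

lemma is_arg_min_add_const_iff:
  fixes f :: "'a \<Rightarrow> real"
  shows "is_arg_min (\<lambda>x. f x + b) P x \<longleftrightarrow> is_arg_min f P x"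
  by (simp add: is_arg_min_def)

text \<open>The middle component is put first so that the outer two form a single summand, constant
  in the variable component.\<close>

lemma norm_triple_squared:
  "(norm (x, y, z))\<^sup>2 = (norm y)\<^sup>2 + ((norm x)\<^sup>2 + (norm z)\<^sup>2)"
  by (simp add: norm_Pair)

lemma is_arg_min_squared_cost_mean:
  fixes Z :: "'i \<Rightarrow> ('d::finite, 'p::finite, 'y::finite) point"
  assumes "finite I" and "I \<noteq> {}" and "convex S" and "\<And>i. i \<in> I \<Longrightarrow> fst (snd (Z i)) \<in> S"
    and min: "is_arg_min (\<lambda>x. \<Sum>i\<in>I. (norm (Z i - (d, x, y)))\<^sup>2) (\<lambda>x. x \<in> S) x"
  shows "x = (1 / real (card I)) *\<^sub>R (\<Sum>i\<in>I. fst (snd (Z i)))"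
proof -
  have split: "(norm (Z i - (d, x, y)))\<^sup>2 = (norm (fst (snd (Z i)) - x))\<^sup>2 +
      ((norm (fst (Z i) - d))\<^sup>2 + (norm (snd (snd (Z i)) - y))\<^sup>2)" for i x
    by (cases "Z i") (simp add: norm_triple_squared)
  have "is_arg_min (\<lambda>x. \<Sum>i\<in>I. (norm (fst (snd (Z i)) - x))\<^sup>2) (\<lambda>x. x \<in> S) x"
    \<comment> \<open>Requiring \<open>h\<close> to be a sum separates the part depending on
      \<open>x\<close> but leaves the two outer blocks together, as one additive constant to be
      dropped.\<close>
    using min unfolding split sum.distrib[where h = "\<lambda>i. _ i + _ i"] is_arg_min_add_const_iff .
  then show ?thesis
    using is_arg_min_sum_norm_squared_mean[OF assms(1-3), of "\<lambda>i. fst (snd (Z i))"] assms(4)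
    by blast
qed

theorem mainTheorem2:
  fixes \<D> :: "(real ^ 'd) set" and \<X> :: "(real ^ 'p) set" and \<Y> :: "(real ^ 'y) set"
    and c :: "('d, 'p, 'y) point \<Rightarrow> ('d, 'p, 'y) point \<Rightarrow> real"
    and Z :: "'n::finite \<Rightarrow> ('d, 'p, 'y) point"
    and Dh :: "'m::finite \<Rightarrow> real ^ 'd" and Yh :: "'m \<Rightarrow> real ^ 'y"
  assumes "finite \<D>" and "finite \<Y>"
    and "\<forall>z\<in>\<D> \<times> \<X> \<times> \<Y>. \<forall>w\<in>\<D> \<times> \<X> \<times> \<Y>. 0 \<le> c z w"
    and "\<forall>i. Z i \<in> \<D> \<times> \<X> \<times> \<Y>"
    and "\<forall>j. Dh j \<in> \<D>" and "\<forall>j. Yh j \<in> \<Y>"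
  shows
    "(\<forall>(C :: real ^ 'm ^ 'n) a.
        (\<forall>i. is_arg_min (\<lambda>j. C $ i $ j) (\<lambda>j. True) (a i)) \<longrightarrow>
        is_arg_min (\<lambda>P. C \<bullet> P) (\<lambda>P. P \<in> plans) (assignment_plan a)) \<and>
     (\<forall>Xk a Xk'.
        (\<forall>j. Xk $ j \<in> \<X>) \<longrightarrow>
        (\<forall>i. is_arg_min (\<lambda>j. cost_matrix c Z Dh Yh Xk $ i $ j) (\<lambda>j. True) (a i)) \<longrightarrow>
        (mm_step c \<X> Z Dh Yh Xk (assignment_plan a) Xk' \<longleftrightarrow>
          lloyd_step c Z (\<lambda>j. {Dh j} \<times> \<X> \<times> {Yh j}) (coreset Dh Yh Xk) a (coreset Dh Yh Xk')) \<and>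
        (mm_step c \<X> Z Dh Yh Xk (assignment_plan a) Xk' \<longrightarrow>
          (\<forall>j. is_arg_min (\<lambda>x. \<Sum>i\<in>cluster a j. c (Z i) (Dh j, x, Yh j))
            (\<lambda>x. x \<in> \<X>) (Xk' $ j))) \<and>
        ((\<forall>z\<in>\<D> \<times> \<X> \<times> \<Y>. \<forall>w\<in>\<D> \<times> \<X> \<times> \<Y>. c z w = l1_norm (z - w)) \<longrightarrow>
          (mm_step c \<X> Z Dh Yh Xk (assignment_plan a) Xk' \<longleftrightarrow>
            k_medians_step Z (\<lambda>j. {Dh j} \<times> \<X> \<times> {Yh j})
              (coreset Dh Yh Xk) a (coreset Dh Yh Xk'))) \<and>
        ((\<forall>z\<in>\<D> \<times> \<X> \<times> \<Y>. \<forall>w\<in>\<D> \<times> \<X> \<times> \<Y>. c z w = (norm (z - w))\<^sup>2) \<longrightarrow>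
          (mm_step c \<X> Z Dh Yh Xk (assignment_plan a) Xk' \<longleftrightarrow>
            k_means_step Z (\<lambda>j. {Dh j} \<times> \<X> \<times> {Yh j})
              (coreset Dh Yh Xk) a (coreset Dh Yh Xk')) \<and>
          (mm_step c \<X> Z Dh Yh Xk (assignment_plan a) Xk' \<and> convex \<X> \<longrightarrow>
            (\<forall>j. cluster a j \<noteq> {} \<longrightarrow>
              Xk' $ j = (1 / real (card (cluster a j))) *\<^sub>R
                (\<Sum>i\<in>cluster a j. fst (snd (Z i)))))))"
proof (rule conjI; intro allI impI)
  fix C :: "real ^ 'm ^ 'n" and a
  assume "\<forall>i. is_arg_min (\<lambda>j. C $ i $ j) (\<lambda>j. True) (a i)"
  then show "is_arg_min (\<lambda>P. C \<bullet> P) (\<lambda>P. P \<in> plans) (assignment_plan a)"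
    by (simp add: assignment_plan_optimal)
next
  fix Xk Xk' :: "(real ^ 'p) ^ 'm" and a :: "'n \<Rightarrow> 'm"
  let ?W = "\<D> \<times> \<X> \<times> \<Y>" and ?A = "\<lambda>j. {Dh j} \<times> \<X> \<times> {Yh j}"
  let ?mm = "mm_step c \<X> Z Dh Yh Xk (assignment_plan a) Xk'"
  assume Xk: "\<forall>j. Xk $ j \<in> \<X>"
    and a: "\<forall>i. is_arg_min (\<lambda>j. cost_matrix c Z Dh Yh Xk $ i $ j) (\<lambda>j. True) (a i)"
  have mm_lloyd: "?mm \<longleftrightarrow> lloyd_step c Z ?A (coreset Dh Yh Xk) a (coreset Dh Yh Xk')"
    using a by (simp add: mm_step_iff_lloyd_step)
  have mm_iff: "?mm \<longleftrightarrow> (\<forall>j. is_arg_min (\<lambda>x. \<Sum>i\<in>cluster a j. c (Z i) (Dh j, x, Yh j))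
      (\<lambda>x. x \<in> \<X>) (Xk' $ j))"
    using a by (simp add: mm_step_assignment_plan_iff)
  \<comment> \<open>Serves both the 1-norm and the squared Euclidean case. The data and all
    candidates in \<open>?A j\<close> lie in \<open>?W\<close>; feasibility of \<open>Xk\<close>
    puts the current centroids there as well.\<close>
  have mm_cong: "?mm \<longleftrightarrow> lloyd_step c' Z ?A (coreset Dh Yh Xk) a (coreset Dh Yh Xk')"
    if "\<forall>z\<in>?W. \<forall>w\<in>?W. c z w = c' z w" for c'
  proof -
    have "c (Z i) w = c' (Z i) w" if "w \<in> ?A j" for i j w
      using that \<open>\<forall>z\<in>?W. \<forall>w\<in>?W. c z w = c' z w\<close> assms(4-6) by blast
    then show ?thesis
      unfolding mm_lloyd using Xk by (intro lloyd_step_cong) (auto simp: coreset_def)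
  qed
  have mean: "Xk' $ j = (1 / real (card (cluster a j))) *\<^sub>R (\<Sum>i\<in>cluster a j. fst (snd (Z i)))"
    if sq: "\<forall>z\<in>?W. \<forall>w\<in>?W. c z w = (norm (z - w))\<^sup>2" and mm: ?mm and "convex \<X>"
      and "cluster a j \<noteq> {}" for j
  proof (rule is_arg_min_squared_cost_mean)
    have "is_arg_min (\<lambda>x. \<Sum>i\<in>cluster a j. c (Z i) (Dh j, x, Yh j)) (\<lambda>x. x \<in> \<X>) (Xk' $ j)"
      using mm mm_iff by blast
    \<comment> \<open>The cost is known to be the squared distance only on \<open>?W\<close>, so the
      objectives are compared only at feasible \<open>x\<close>, which suffices for
      \<open>is_arg_min_cong\<close>.\<close>
    moreover have "(\<Sum>i\<in>cluster a j. c (Z i) (Dh j, x, Yh j)) =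
        (\<Sum>i\<in>cluster a j. (norm (Z i - (Dh j, x, Yh j)))\<^sup>2)" if "x \<in> \<X>" for x
      using that sq assms(4-6) by (intro sum.cong refl) blast
    ultimately show "is_arg_min (\<lambda>x. \<Sum>i\<in>cluster a j. (norm (Z i - (Dh j, x, Yh j)))\<^sup>2)
        (\<lambda>x. x \<in> \<X>) (Xk' $ j)"
      using is_arg_min_cong[of "\<lambda>x. x \<in> \<X>"] by (metis (no_types, lifting))
    show "fst (snd (Z i)) \<in> \<X>" for i
      using assms(4) by (metis mem_Times_iff)
  qed (use that in auto)
  show "(?mm \<longleftrightarrow> lloyd_step c Z ?A (coreset Dh Yh Xk) a (coreset Dh Yh Xk')) \<and>
    (?mm \<longrightarrow> (\<forall>j. is_arg_min (\<lambda>x. \<Sum>i\<in>cluster a j. c (Z i) (Dh j, x, Yh j))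
      (\<lambda>x. x \<in> \<X>) (Xk' $ j))) \<and>
    ((\<forall>z\<in>?W. \<forall>w\<in>?W. c z w = l1_norm (z - w)) \<longrightarrow>
      (?mm \<longleftrightarrow> k_medians_step Z ?A (coreset Dh Yh Xk) a (coreset Dh Yh Xk'))) \<and>
    ((\<forall>z\<in>?W. \<forall>w\<in>?W. c z w = (norm (z - w))\<^sup>2) \<longrightarrow>
      (?mm \<longleftrightarrow> k_means_step Z ?A (coreset Dh Yh Xk) a (coreset Dh Yh Xk')) \<and>
      (?mm \<and> convex \<X> \<longrightarrow> (\<forall>j. cluster a j \<noteq> {} \<longrightarrow>
        Xk' $ j = (1 / real (card (cluster a j))) *\<^sub>R (\<Sum>i\<in>cluster a j. fst (snd (Z i))))))"
  proof (intro conjI impI allI)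
    show "?mm \<longleftrightarrow> lloyd_step c Z ?A (coreset Dh Yh Xk) a (coreset Dh Yh Xk')"
      by (rule mm_lloyd)
  next
    fix j
    assume ?mm
    then show "is_arg_min (\<lambda>x. \<Sum>i\<in>cluster a j. c (Z i) (Dh j, x, Yh j))
        (\<lambda>x. x \<in> \<X>) (Xk' $ j)"
      using mm_iff by blast
  next
    assume "\<forall>z\<in>?W. \<forall>w\<in>?W. c z w = l1_norm (z - w)"
    then show "?mm \<longleftrightarrow> k_medians_step Z ?A (coreset Dh Yh Xk) a (coreset Dh Yh Xk')"
      unfolding k_medians_step_def by (rule mm_cong)
  next
    assume "\<forall>z\<in>?W. \<forall>w\<in>?W. c z w = (norm (z - w))\<^sup>2"
    then show "?mm \<longleftrightarrow> k_means_step Z ?A (coreset Dh Yh Xk) a (coreset Dh Yh Xk')"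
      unfolding k_means_step_def by (rule mm_cong)
  next
    fix j
    assume "\<forall>z\<in>?W. \<forall>w\<in>?W. c z w = (norm (z - w))\<^sup>2" and "?mm \<and> convex \<X>"
      and "cluster a j \<noteq> {}"
    then show "Xk' $ j = (1 / real (card (cluster a j))) *\<^sub>R (\<Sum>i\<in>cluster a j. fst (snd (Z i)))"
      using mean by blast
  qed
qed

end
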